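(* Let $(X,d)$ be a metric space and let $A,B\subset X$ be non-empty finite subsets. Then the mergegrams of their single-linkage dendrograms satisfy $$\mathrm{BD}\bigl(\mathrm{MG}(\Delta_{SL}(A)),\mathrm{MG}(\Delta_{SL}(B))\bigr)\le \mathrm{HD}(A,B).$$
   Context: Single-linkage dendrogram: for a non-empty finite subset $A$ of a metric space $(X,d)$ and a scale $s\ge 0$, two points $a,b\in A$ belong to the same cluster at scale $s$ if and only if there is a finite sequence $a=a_1,\dots,a_m=b$ in $A$ with $d(a_i,a_{i+1})\le 2s$ for $i=1,\dots,m-1$ (so clusters merge at scales equal to half-lengths of edges of a Minimum Spanning Tree of $A$). Let $\Delta_{SL}(A;s)$ be the partition of $A$ into these clusters; $\Delta_{SL}(A)$ is the function $s\mapsto\Delta_{SL}(A;s)$. Mergegram: as $s$ grows, the partition $\Delta=\Delta_{SL}(A)$ changes at finitely many scales $0=s_0<s_1<\dots<s_m$ (merge scales), is constant on each $[s_i,s_{i+1})$ and on $[s_m,+\infty)$, and equals $\{A\}$ for $s\ge s_m$. A merge set is either a block of the partition at $s=0$ (birth scale $0$), or a block of the partition at $s_{i+1}$ that is the union of at least two blocks of the partition at $s_i$ (birth scale $s_{i+1}$). The death scale of a merge set $C$ with birth $b$ is $\sup\{s\ge b: C \text{ is a block of the partition at scale } s\}\in(b,+\infty]$. The mergegram $\mathrm{MG}(\Delta)$ is the multiset of pairs $(\mathrm{birth},\mathrm{death})$ over all merge sets, with multiplicity. Hausdorff distance: $\mathrm{HD}(A,B)=\max\{\sup_{p\in A}\inf_{q\in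 B}d(p,q),\ \sup_{q\in B}\inf_{p\in A}d(p,q)\}$. Bottleneck distance: to each finite multiset of pairs $(p,q)$ with $p<q\le+\infty$ add all diagonal points $(p,p)$, $p\in\mathbb{R}$, with infinite multiplicity, obtaining multisets $C,D$. For $\delta\ge 0$, a $\delta$-matching is a bijection $h:C\to D$ (of multisets) such that $|h(a)-a|_\infty\le\delta$ for every $a\in C$, where $|(p,q)-(p',q')|_\infty=\max\{|p-p'|,|q-q'|\}$ with the convention that $|q-q'|=0$ if $q=q'=+\infty$ and $|q-q'|=+\infty$ if exactly one of $q,q'$ is $+\infty$. Then $\mathrm{BD}$ is the infimum of all $\delta\ge 0$ for which a $\delta$-matching exists. *)

theory Defs
  imports "HOL-Analysis.Analysis" "HOL-Library.Multiset" "HOL-Library.Extended_Nat"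
begin

definition same_cluster :: "'a::metric_space set \<Rightarrow> real \<Rightarrow> 'a \<Rightarrow> 'a \<Rightarrow> bool" where
  "same_cluster A s a b \<longleftrightarrow>
     (\<exists>xs. xs \<noteq> [] \<and> set xs \<subseteq> A \<and> hd xs = a \<and> last xs = b \<and>
           successively (\<lambda>x y. dist x y \<le> 2 * s) xs)"

definition single_linkage :: "'a::metric_space set \<Rightarrow> real \<Rightarrow> 'a set set" where
  "single_linkage A s = A // {(a, b). a \<in> A \<and> b \<in> A \<and> same_cluster A s a b}"

text \<open>In the following, a dendrogram is a function from scales \<open>s \<ge> 0\<close> to partitions; its values
  at negative scales are never used. A positive scale is a change scale if the function is not
  constant on any interval \<open>[r, s]\<close> with \<open>0 \<le> r < s\<close>. For a dendrogram that is constant on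
  \<open>[s\<^sub>i, s\<^sub>i\<^sub>+\<^sub>1)\<close> and on \<open>[s\<^sub>m, \<infinity>)\<close>, with a change at each of \<open>s\<^sub>1 < \<dots> < s\<^sub>m\<close>,
  the set of merge scales below is \<open>{s\<^sub>0, \<dots>, s\<^sub>m}\<close> with \<open>s\<^sub>0 = 0\<close>.\<close>

definition merge_scales :: "(real \<Rightarrow> 'a set set) \<Rightarrow> real set" where
  "merge_scales \<Delta> = insert 0 {s. 0 < s \<and> (\<forall>r. 0 \<le> r \<and> r < s \<longrightarrow> (\<exists>t\<in>{r..<s}. \<Delta> t \<noteq> \<Delta> s))}"

definition consecutive_merge_scales :: "(real \<Rightarrow> 'a set set) \<Rightarrow> real \<Rightarrow> real \<Rightarrow> bool" where
  "consecutive_merge_scales \<Delta> r s \<longleftrightarrow>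
     r \<in> merge_scales \<Delta> \<and> s \<in> merge_scales \<Delta> \<and> r < s \<and> merge_scales \<Delta> \<inter> {r<..<s} = {}"

definition merge_set_born_at :: "(real \<Rightarrow> 'a set set) \<Rightarrow> 'a set \<Rightarrow> real \<Rightarrow> bool" where
  "merge_set_born_at \<Delta> C b \<longleftrightarrow>
     (b = 0 \<and> C \<in> \<Delta> 0) \<or>
     (\<exists>r. consecutive_merge_scales \<Delta> r b \<and> C \<in> \<Delta> b \<and>
          (\<exists>F\<subseteq>\<Delta> r. (\<exists>D\<in>F. \<exists>E\<in>F. D \<noteq> E) \<and> C = \<Union>F))"

definition death_scale :: "(real \<Rightarrow> 'a set set) \<Rightarrow> 'a set \<Rightarrow> real \<Rightarrow> ereal" where
  "death_scale \<Delta> C b = (SUP s\<in>{s. b \<le> s \<and> C \<in> \<Delta> s}. ereal s)"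

text \<open>For the dendrogram of a finite set, the set of pairs (merge set, birth scale) is finite, so
  \<open>mset_set\<close> lists each of them exactly once.\<close>

definition mergegram :: "(real \<Rightarrow> 'a set set) \<Rightarrow> (real \<times> ereal) multiset" where
  "mergegram \<Delta> =
     image_mset (\<lambda>(C, b). (b, death_scale \<Delta> C b)) (mset_set {(C, b). merge_set_born_at \<Delta> C b})"

definition hausdorff_dist :: "'a::metric_space set \<Rightarrow> 'a set \<Rightarrow> real" where
  "hausdorff_dist A B = max (SUP p\<in>A. INF q\<in>B. dist p q) (SUP q\<in>B. INF p\<in>A. dist p q)"

text \<open>The first case implements the convention \<open>\<bar>\<infinity> - \<infinity>\<bar> = 0\<close> (in \<^typ>\<open>ereal\<close>, \<open>\<infinity> - \<infinity> = \<infinity>\<close>);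
  if exactly one of \<open>q\<close>, \<open>q'\<close> is \<open>\<infinity>\<close>, then \<open>\<bar>q - q'\<bar> = \<infinity>\<close> by the arithmetic of \<^typ>\<open>ereal\<close>.\<close>

definition linf_dist :: "real \<times> ereal \<Rightarrow> real \<times> ereal \<Rightarrow> ereal" where
  "linf_dist = (\<lambda>(p, q) (p', q').
     max (ereal \<bar>p - p'\<bar>) (if q = \<infinity> \<and> q' = \<infinity> then 0 else \<bar>q - q'\<bar>))"

text \<open>Multiplicity of a point after adding all diagonal points with (countably) infinite
  multiplicity. A multiset with infinite multiplicities is represented by the set of its labelled
  copies \<open>(x, k)\<close>, where \<open>k\<close> runs through the natural numbers below the multiplicity of \<open>x\<close>; a
  bijection of multisets is a bijection between the sets of copies.\<close>

definition diag_mult :: "(real \<times> ereal) multiset \<Rightarrow> real \<times> ereal \<Rightarrow> enat" where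
  "diag_mult M x = enat (count M x) + (if snd x = ereal (fst x) then \<infinity> else 0)"

definition diag_copies :: "(real \<times> ereal) multiset \<Rightarrow> ((real \<times> ereal) \<times> nat) set" where
  "diag_copies M = {(x, k). enat k < diag_mult M x}"

definition is_matching ::
  "real \<Rightarrow> (real \<times> ereal) multiset \<Rightarrow> (real \<times> ereal) multiset \<Rightarrow>
   ((real \<times> ereal) \<times> nat \<Rightarrow> (real \<times> ereal) \<times> nat) \<Rightarrow> bool" where
  "is_matching \<delta> M N h \<longleftrightarrow>
     bij_betw h (diag_copies M) (diag_copies N) \<and>
     (\<forall>a\<in>diag_copies M. linf_dist (fst (h a)) (fst a) \<le> ereal \<delta>)"

text \<open>The infimum is taken in \<^typ>\<open>ereal\<close>, so that it is \<open>\<infinity>\<close> if there is no matching at all.\<close>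

definition bottleneck_dist ::
  "(real \<times> ereal) multiset \<Rightarrow> (real \<times> ereal) multiset \<Rightarrow> ereal" where
  "bottleneck_dist M N = (INF \<delta>\<in>{\<delta>. 0 \<le> \<delta> \<and> (\<exists>h. is_matching \<delta> M N h)}. ereal \<delta>)"

end

theory Submission
  imports Defs
begin

text \<open>Let \<open>\<delta>\<close> be the Hausdorff distance and let \<open>near \<delta> B C\<close> be the set of points of \<open>B\<close> within
  distance \<open>\<delta>\<close> of \<open>C\<close>. If \<open>C\<close> is a cluster of \<open>A\<close> at both scales \<open>s\<close> and \<open>s + 2\<delta>\<close>, then
  \<open>near \<delta> B C\<close> is a cluster of \<open>B\<close> at scale \<open>s + \<delta>\<close>, and \<open>C\<close> is recovered from it as the set of
  points of \<open>A\<close> near it. So \<open>C \<mapsto> near \<delta> B C\<close> matches the merge sets of life span more than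
  \<open>2\<delta>\<close>, on either side, up to an error \<open>\<delta>\<close> in birth and death; the unmatched points of either
  mergegram are at distance at most \<open>\<delta>\<close> from the diagonal.\<close>

section \<open>Matchings from couplings\<close>

definition on_diag :: "real \<times> ereal \<Rightarrow> bool" where
  "on_diag x \<longleftrightarrow> snd x = ereal (fst x)"

text \<open>A pair \<open>(x, x)\<close> on the diagonal gets infinitely many copies, so both projections of the
  labelled pairs have the multiplicities \<^const>\<open>diag_mult\<close>.\<close>

definition coupling_copies ::
  "((real \<times> ereal) \<times> (real \<times> ereal)) multiset \<Rightarrow> (((real \<times> ereal) \<times> (real \<times> ereal)) \<times> nat) set" where
  "coupling_copies W = {(w, k). k < count W w \<or> (fst w = snd w \<and> on_diag (fst w))}"

text \<open>Fibrewise: \<open>x\<close> has \<open>count M x\<close> copies in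
  \<open>diag_copies M\<close> off the diagonal and countably many on it, so each fibre of
  \<open>g\<close> is in bijection with the copies of its value. These bijections glue.\<close>

lemma bij_betw_diag_copies:
  assumes "\<And>x. \<not> on_diag x \<Longrightarrow> finite {k\<in>K. g k = x} \<and> card {k\<in>K. g k = x} = count M x"
    and "\<And>x. on_diag x \<Longrightarrow> countable {k\<in>K. g k = x} \<and> infinite {k\<in>K. g k = x}"
  shows "\<exists>f. bij_betw f K (diag_copies M) \<and> (\<forall>k\<in>K. fst (f k) = g k)"
proof -
  have "\<exists>f. bij_betw f {k\<in>K. g k = x} {n. enat n < diag_mult M x}" for x
  proof (cases "on_diag x")
    case True
    then have "{n. enat n < diag_mult M x} = UNIV"
      by (auto simp: diag_mult_def on_diag_def)
    then show ?thesis
      using countableE_infinite[of "{k\<in>K. g k = x}"] assms(2)[OF True] by metis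
  next
    case False
    then have "{n. enat n < diag_mult M x} = {..<count M x}"
      by (auto simp: diag_mult_def on_diag_def)
    then show ?thesis
      using assms(1)[OF False] by (simp add: bij_betw_iff_card)
  qed
  then obtain f where f: "\<And>x. bij_betw (f x) {k\<in>K. g k = x} {n. enat n < diag_mult M x}"
    by metis
  have "bij_betw (\<lambda>k. (g k, f (g k) k)) K (diag_copies M)"
    unfolding bij_betw_def
  proof
    show "inj_on (\<lambda>k. (g k, f (g k) k)) K"
    proof (rule inj_onI)
      fix x y assume "x \<in> K" "y \<in> K" "(g x, f (g x) x) = (g y, f (g y) y)"
      then show "x = y"
        using inj_onD[OF bij_betw_imp_inj_on[OF f[of "g y"]], of x y] by auto
    qed
    show "(\<lambda>k. (g k, f (g k) k)) ` K = diag_copies M"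
    proof (intro equalityI subsetI)
      fix z assume "z \<in> (\<lambda>k. (g k, f (g k) k)) ` K"
      then show "z \<in> diag_copies M"
        using f unfolding bij_betw_def diag_copies_def by fastforce
    next
      fix z assume "z \<in> diag_copies M"
      then obtain x n where z: "z = (x, n)" "enat n < diag_mult M x"
        by (auto simp: diag_copies_def)
      then have "n \<in> f x ` {k\<in>K. g k = x}"
        using f[of x] by (simp add: bij_betw_def)
      then show "z \<in> (\<lambda>k. (g k, f (g k) k)) ` K"
        using z by auto
    qed
  qed
  then show ?thesis by (intro exI) auto
qed

text \<open>Applied with \<open>fst\<close> and \<open>snd\<close> for \<open>g\<close>. Only the
  off-diagonal part of \<open>M\<close> has to agree with the marginal of \<open>W\<close>, since
  every diagonal point has infinitely many copies anyway.\<close>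

lemma bij_betw_coupling_copies:
  assumes M: "filter_mset (\<lambda>x. \<not> on_diag x) (image_mset g W) = filter_mset (\<lambda>x. \<not> on_diag x) M"
    and g: "\<And>x. g (x, x) = x"
  shows "\<exists>f. bij_betw f (coupling_copies W) (diag_copies M)
            \<and> (\<forall>k\<in>coupling_copies W. fst (f k) = g (fst k))"
proof (rule bij_betw_diag_copies)
  fix x assume x: "\<not> on_diag x"
  \<comment> \<open>The extra copies of diagonal pairs \<open>(y, y)\<close> project to
    \<open>y\<close>, never to the off-diagonal \<open>x\<close>; only copies counted by
    \<open>W\<close> remain.\<close>
  have eq: "{k\<in>coupling_copies W. g (fst k) = x}
      = Sigma (g -` {x} \<inter> set_mset W) (\<lambda>w. {..<count W w})"
    using x g by (auto simp: coupling_copies_def) (metis count_eq_zero_iff not_less_zero)+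
  have "count M x = count (image_mset g W) x"
    using arg_cong[OF M, of "\<lambda>X. count X x"] x by simp
  then show "finite {k\<in>coupling_copies W. g (fst k) = x}
      \<and> card {k\<in>coupling_copies W. g (fst k) = x} = count M x"
    unfolding eq by (auto simp: count_image_mset)
next
  fix x assume x: "on_diag x"
  let ?F = "{k\<in>coupling_copies W. g (fst k) = x}"
  have sub: "?F \<subseteq> insert (x, x) (set_mset W) \<times> UNIV"
    using g by (auto simp: coupling_copies_def) (metis count_eq_zero_iff not_less_zero)+
  have "countable ?F"
    by (rule countable_subset[OF sub]) (intro countable_SIGMA countable_insert; simp add: countable_finite)
  moreover have "(\<lambda>n. ((x, x), n)) ` (UNIV :: nat set) \<subseteq> ?F"
    using x g by (auto simp: coupling_copies_def)
  then have "infinite ?F"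
    by (meson finite_subset finite_imageD infinite_UNIV_nat inj_onI prod.inject)
  ultimately show "countable ?F \<and> infinite ?F" by blast
qed

lemma linf_dist_diag_self: "on_diag x \<Longrightarrow> linf_dist x x = 0"
  by (cases x) (auto simp: linf_dist_def on_diag_def)

text \<open>Going back along one marginal of \<open>coupling_copies W\<close> and forward along the
  other gives the matching. The extra diagonal pairs cost 0.\<close>

lemma is_matching_of_coupling:
  assumes M: "filter_mset (\<lambda>x. \<not> on_diag x) (image_mset fst W) = filter_mset (\<lambda>x. \<not> on_diag x) M"
    and N: "filter_mset (\<lambda>x. \<not> on_diag x) (image_mset snd W) = filter_mset (\<lambda>x. \<not> on_diag x) N"
    and W: "\<And>x y. (x, y) \<in># W \<Longrightarrow> linf_dist y x \<le> ereal \<delta>"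
    and "0 \<le> \<delta>"
  shows "\<exists>h. is_matching \<delta> M N h"
proof -
  let ?K = "coupling_copies W"
  obtain f where f: "bij_betw f ?K (diag_copies M)" "\<And>k. k \<in> ?K \<Longrightarrow> fst (f k) = fst (fst k)"
    using bij_betw_coupling_copies[OF M] by auto
  obtain f' where f': "bij_betw f' ?K (diag_copies N)" "\<And>k. k \<in> ?K \<Longrightarrow> fst (f' k) = snd (fst k)"
    using bij_betw_coupling_copies[OF N] by auto
  let ?h = "f' \<circ> inv_into ?K f"
  have "bij_betw ?h (diag_copies M) (diag_copies N)"
    using bij_betw_trans[OF bij_betw_inv_into[OF f(1)] f'(1)] .
  moreover have "linf_dist (fst (?h a)) (fst a) \<le> ereal \<delta>" if a: "a \<in> diag_copies M" for a
  proof -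
    obtain k where k: "k \<in> ?K" "a = f k"
      using a bij_betw_imp_surj_on[OF f(1)] by blast
    then have "inv_into ?K f a = k"
      using f(1) by (simp add: bij_betw_def inv_into_f_f)
    then have h: "fst (?h a) = snd (fst k)" "fst a = fst (fst k)"
      using k f(2) f'(2) by auto
    obtain x y n where xy: "k = ((x, y), n)" by (metis surj_pair)
    consider "(x, y) \<in># W" | "x = y" "on_diag x"
      using k(1) xy by (auto simp: coupling_copies_def count_greater_zero_iff[symmetric]
          simp del: count_greater_zero_iff)
    then show ?thesis
      using h xy W \<open>0 \<le> \<delta>\<close> by cases (auto simp: linf_dist_diag_self)
  qed
  ultimately show ?thesis
    unfolding is_matching_def by blast
qed

text \<open>The coupling consists of the pairs in \<open>S\<close> and of each unmatched index
  paired with a nearby diagonal point. Index sets keep distinct merge sets apart even if their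
  births and deaths agree.\<close>

lemma is_matching_of_partial_matching:
  assumes fin: "finite I" "finite J" and S: "S \<subseteq> I \<times> J" "inj_on fst S" "inj_on snd S"
    and close: "\<And>i j. (i, j) \<in> S \<Longrightarrow> linf_dist (q j) (p i) \<le> ereal \<delta>"
    and I': "\<And>i. i \<in> I - fst ` S \<Longrightarrow> \<exists>x. on_diag x \<and> linf_dist x (p i) \<le> ereal \<delta>"
    and J': "\<And>j. j \<in> J - snd ` S \<Longrightarrow> \<exists>x. on_diag x \<and> linf_dist (q j) x \<le> ereal \<delta>"
    and "0 \<le> \<delta>"
  shows "\<exists>h. is_matching \<delta> (image_mset p (mset_set I)) (image_mset q (mset_set J)) h"
proof -
  obtain u where u: "\<And>i. i \<in> I - fst ` S \<Longrightarrow> on_diag (u i) \<and> linf_dist (u i) (p i) \<le> ereal \<delta>"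
    using I' by metis
  obtain v where v: "\<And>j. j \<in> J - snd ` S \<Longrightarrow> on_diag (v j) \<and> linf_dist (q j) (v j) \<le> ereal \<delta>"
    using J' by metis
  have subI: "fst ` S \<subseteq> I" and subJ: "snd ` S \<subseteq> J"
    using S(1) by auto
  have finS: "finite S"
    using finite_subset[OF S(1)] fin by simp
  define W where "W = image_mset (\<lambda>(i, j). (p i, q j)) (mset_set S)
     + image_mset (\<lambda>i. (p i, u i)) (mset_set (I - fst ` S))
     + image_mset (\<lambda>j. (v j, q j)) (mset_set (J - snd ` S))"
  have "image_mset p (mset_set I)
      = image_mset p (mset_set (fst ` S)) + image_mset p (mset_set (I - fst ` S))"
    using mset_set_Union[of "fst ` S" "I - fst ` S"] subI fin finS by (simp add: Un_absorb1)
  also have "mset_set (fst ` S) = image_mset fst (mset_set S)"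
    using S(2) by (simp add: image_mset_mset_set)
  finally have splitI: "image_mset p (mset_set I)
      = image_mset (\<lambda>s. p (fst s)) (mset_set S) + image_mset p (mset_set (I - fst ` S))"
    by (simp add: multiset.map_comp comp_def)
  have "image_mset q (mset_set J)
      = image_mset q (mset_set (snd ` S)) + image_mset q (mset_set (J - snd ` S))"
    using mset_set_Union[of "snd ` S" "J - snd ` S"] subJ fin finS by (simp add: Un_absorb1)
  also have "mset_set (snd ` S) = image_mset snd (mset_set S)"
    using S(3) by (simp add: image_mset_mset_set)
  finally have splitJ: "image_mset q (mset_set J)
      = image_mset (\<lambda>s. q (snd s)) (mset_set S) + image_mset q (mset_set (J - snd ` S))"
    by (simp add: multiset.map_comp comp_def)
  \<comment> \<open>The diagonal partners \<open>v j\<close> disappear off the diagonal, where the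
    first marginal therefore agrees with the points \<open>p i\<close>.\<close>
  have "filter_mset (\<lambda>x. \<not> on_diag x) (image_mset v (mset_set (J - snd ` S))) = {#}"
    using v fin by auto
  then have M: "filter_mset (\<lambda>x. \<not> on_diag x) (image_mset fst W)
      = filter_mset (\<lambda>x. \<not> on_diag x) (image_mset p (mset_set I))"
    unfolding W_def splitI by (simp add: multiset.map_comp comp_def case_prod_unfold)
  have "filter_mset (\<lambda>x. \<not> on_diag x) (image_mset u (mset_set (I - fst ` S))) = {#}"
    using u fin by auto
  then have N: "filter_mset (\<lambda>x. \<not> on_diag x) (image_mset snd W)
      = filter_mset (\<lambda>x. \<not> on_diag x) (image_mset q (mset_set J))"
    unfolding W_def splitJ by (simp add: multiset.map_comp comp_def case_prod_unfold)
  have "linf_dist y x \<le> ereal \<delta>" if "(x, y) \<in># W" for x y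
    using that close u v fin finS by (auto simp: W_def)
  from is_matching_of_coupling[OF M N this \<open>0 \<le> \<delta>\<close>] show ?thesis .
qed

section \<open>Births and deaths in a dendrogram\<close>

text \<open>\<open>locally_const\<close> says that changes occur only at scales in the finite set
  \<open>T\<close>, and that the partition at such a scale is already the new one
  (right-continuity).\<close>

locale dendrogram =
  fixes \<Delta> :: "real \<Rightarrow> 'a set set" and A :: "'a set" and T :: "real set"
  assumes finite_base: "finite A"
    and partition: "0 \<le> s \<Longrightarrow> partition_on A (\<Delta> s)"
    and coarsening: "0 \<le> s \<Longrightarrow> s \<le> t \<Longrightarrow> C \<in> \<Delta> s \<Longrightarrow> \<exists>D\<in>\<Delta> t. C \<subseteq> D"
    and finite_scales: "finite T"
    and locally_const: "0 \<le> s \<Longrightarrow> \<exists>t\<in>T. 0 \<le> t \<and> t \<le> s \<and> (\<forall>u\<in>{t..s}. \<Delta> u = \<Delta> s)"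
begin

lemma block_eqI: "0 \<le> s \<Longrightarrow> C \<in> \<Delta> s \<Longrightarrow> D \<in> \<Delta> s \<Longrightarrow> x \<in> C \<Longrightarrow> x \<in> D \<Longrightarrow> C = D"
  using partition[of s] unfolding partition_on_def disjoint_def by blast

lemma block_nonempty: "0 \<le> s \<Longrightarrow> C \<in> \<Delta> s \<Longrightarrow> C \<noteq> {}"
  using partition[of s] unfolding partition_on_def by blast

lemma block_subset: "0 \<le> s \<Longrightarrow> C \<in> \<Delta> s \<Longrightarrow> C \<subseteq> A"
  using partition[of s] unfolding partition_on_def by blast

lemma block_of: "0 \<le> s \<Longrightarrow> x \<in> A \<Longrightarrow> \<exists>C\<in>\<Delta> s. x \<in> C"
  using partition[of s] unfolding partition_on_def by blast

lemma block_subset_block: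
  assumes "0 \<le> s" "s \<le> t" "C \<in> \<Delta> s" "D \<in> \<Delta> t" "x \<in> C" "x \<in> D"
  shows "C \<subseteq> D"
  using coarsening[OF assms(1-3)] block_eqI[of t] assms by (metis order_trans subsetD)

text \<open>The block at \<open>u\<close> that contains \<open>C\<close> is squeezed between the
  block \<open>C\<close> at \<open>s\<close> and the block \<open>C\<close> at
  \<open>t\<close>.\<close>

lemma block_convex:
  assumes "0 \<le> s" "s \<le> u" "u \<le> t" "C \<in> \<Delta> s" "C \<in> \<Delta> t"
  shows "C \<in> \<Delta> u"
proof -
  obtain D where D: "D \<in> \<Delta> u" "C \<subseteq> D"
    using coarsening[of s u C] assms by auto
  obtain x where "x \<in> C"
    using block_nonempty assms(1,4) by blast
  then have "D \<subseteq> C"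
    using block_subset_block[of u t D C x] assms D by auto
  with D show ?thesis by auto
qed

text \<open>A positive change scale \<open>s\<close> lies in \<open>T\<close>: otherwise the
  partition would be constant on some \<open>[t, s]\<close> with \<open>t\<close> in
  \<open>T\<close> and \<open>t < s\<close>.\<close>

lemma finite_merge_scales: "finite (merge_scales \<Delta>)"
proof (rule finite_subset)
  show "merge_scales \<Delta> \<subseteq> insert 0 T"
  proof
    fix s assume s: "s \<in> merge_scales \<Delta>"
    show "s \<in> insert 0 T"
    proof (rule ccontr)
      assume n: "s \<notin> insert 0 T"
      then have "0 < s" using s by (auto simp: merge_scales_def)
      then obtain t where t: "t \<in> T" "0 \<le> t" "t \<le> s" "\<forall>u\<in>{t..s}. \<Delta> u = \<Delta> s"
        using locally_const[of s] by auto
      with n have "t < s" by (metis insertCI order_le_less)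
      then obtain u where "u \<in> {t..<s}" "\<Delta> u \<noteq> \<Delta> s"
        using s t(2) \<open>0 < s\<close> unfolding merge_scales_def by blast
      then show False using bspec[OF t(4), of u] by simp
    qed
  qed
  show "finite (insert 0 T)" using finite_scales by simp
qed

text \<open>A description of the birth scale that does not refer to merge scales;
  \<open>merge_set_born_at_iff\<close> shows the equivalence.\<close>

definition first_scale :: "'a set \<Rightarrow> real \<Rightarrow> bool" where
  "first_scale C b \<longleftrightarrow> 0 \<le> b \<and> C \<in> \<Delta> b \<and> (\<forall>t. 0 \<le> t \<and> t < b \<longrightarrow> C \<notin> \<Delta> t)"

lemma first_scale_unique: "first_scale C b \<Longrightarrow> first_scale C b' \<Longrightarrow> b = b'"
  unfolding first_scale_def by (meson linorder_neqE)

text \<open>A minimum over the finite set \<open>T\<close> suffices: if \<open>C\<close> is a block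
  at \<open>u\<close>, it is already one at some scale of \<open>T\<close> not above
  \<open>u\<close>.\<close>

lemma first_scale_exists:
  assumes "0 \<le> s" "C \<in> \<Delta> s"
  shows "\<exists>b\<le>s. first_scale C b"
proof -
  let ?X = "{t\<in>T. 0 \<le> t \<and> C \<in> \<Delta> t}"
  have ex: "\<exists>t\<in>?X. t \<le> u" if "0 \<le> u" "C \<in> \<Delta> u" for u
    using locally_const[OF that(1)] that(2)
    by (metis (no_types, lifting) atLeastAtMost_iff mem_Collect_eq order_refl)
  then have ne: "?X \<noteq> {}" using assms by blast
  have fin: "finite ?X" using finite_scales by simp
  have "C \<notin> \<Delta> u" if u: "0 \<le> u" "u < Min ?X" for u
  proof
    assume "C \<in> \<Delta> u"
    then obtain t where "t \<in> ?X" "t \<le> u" using ex[OF u(1)] by blast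
    then show False using Min_le[OF fin, of t] u(2) by linarith
  qed
  then have "first_scale C (Min ?X)"
    using Min_in[OF fin ne] unfolding first_scale_def by blast
  moreover have "Min ?X \<le> s"
    using ex[OF assms] Min_le[OF fin] by (meson order_trans)
  ultimately show ?thesis by blast
qed

lemma first_scale_merge_scale:
  assumes "first_scale C b"
  shows "b \<in> merge_scales \<Delta>"
proof -
  have "\<exists>t\<in>{r..<b}. \<Delta> t \<noteq> \<Delta> b" if "0 \<le> r" "r < b" for r
    using that assms by (intro bexI[of _ r]) (auto simp: first_scale_def)
  then show ?thesis
    using assms by (auto simp: merge_scales_def first_scale_def)
qed

lemma merge_scale_nonneg: "s \<in> merge_scales \<Delta> \<Longrightarrow> 0 \<le> s"
  by (auto simp: merge_scales_def)

text \<open>A block first seen at \<open>b > 0\<close> is the union of the blocks it contains at the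
  previous merge scale, and there are at least two of them. Conversely, a union of distinct blocks
  at \<open>r\<close> is a block at no scale up to \<open>r\<close>; its first scale is a merge
  scale, hence not strictly between \<open>r\<close> and \<open>b\<close>.\<close>

lemma merge_set_born_at_iff: "merge_set_born_at \<Delta> C b \<longleftrightarrow> first_scale C b"
proof
  assume b: "first_scale C b"
  then have C: "C \<in> \<Delta> b" "0 \<le> b" by (auto simp: first_scale_def)
  show "merge_set_born_at \<Delta> C b"
  proof (cases "b = 0")
    case True
    then show ?thesis using C by (simp add: merge_set_born_at_def)
  next
    case False
    let ?X = "merge_scales \<Delta> \<inter> {..<b}"
    have fin: "finite ?X" using finite_merge_scales by simp
    have "0 \<in> ?X" using False C by (simp add: merge_scales_def)
    then have ne: "?X \<noteq> {}" by blast
    \<comment> \<open>The last merge scale before \<open>b\<close>; it exists because 0 always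
      counts as one.\<close>
    define r where "r = Max ?X"
    have r: "r \<in> merge_scales \<Delta>" "r < b"
      using Max_in[OF fin ne] by (auto simp: r_def)
    have r0: "0 \<le> r" using r merge_scale_nonneg by blast
    have "merge_scales \<Delta> \<inter> {r<..<b} = {}"
      using Max_ge[OF fin] by (force simp: r_def)
    then have cons: "consecutive_merge_scales \<Delta> r b"
      using r first_scale_merge_scale[OF b] by (simp add: consecutive_merge_scales_def)
    define F where "F = {D\<in>\<Delta> r. D \<subseteq> C}"
    have CF: "C = \<Union>F"
    proof (intro equalityI subsetI)
      fix x assume x: "x \<in> C"
      then obtain D where D: "D \<in> \<Delta> r" "x \<in> D"
        using block_of[OF r0] block_subset[OF C(2,1)] by blast
      then have "D \<subseteq> C"
        using block_subset_block[of r b D C x] r r0 C x by auto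
      with D show "x \<in> \<Union>F" by (auto simp: F_def)
    qed (auto simp: F_def)
    \<comment> \<open>If \<open>F\<close> had a single member, this would be \<open>C\<close>, which
      would then be a block before \<open>b\<close>.\<close>
    have "\<exists>D\<in>F. \<exists>E\<in>F. D \<noteq> E"
    proof (rule ccontr)
      assume n: "\<not> (\<exists>D\<in>F. \<exists>E\<in>F. D \<noteq> E)"
      obtain D where "D \<in> F"
        using CF block_nonempty[OF C(2,1)] by blast
      with n have "F = {D}" by blast
      then have "C = D" using CF by simp
      then have "C \<in> \<Delta> r" using \<open>D \<in> F\<close> by (simp add: F_def)
      then show False using b r r0 by (auto simp: first_scale_def)
    qed
    moreover have "F \<subseteq> \<Delta> r" by (auto simp: F_def)
    ultimately show ?thesis
      unfolding merge_set_born_at_def using cons C CF by blast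
  qed
next
  assume "merge_set_born_at \<Delta> C b"
  then consider "b = 0" "C \<in> \<Delta> 0"
    | r F D E where "consecutive_merge_scales \<Delta> r b" "C \<in> \<Delta> b" "F \<subseteq> \<Delta> r" "D \<in> F" "E \<in> F"
        "D \<noteq> E" "C = \<Union>F"
    unfolding merge_set_born_at_def by blast
  then show "first_scale C b"
  proof cases
    case 1
    then show ?thesis by (force simp: first_scale_def)
  next
    case 2
    have rb: "r < b" "r \<in> merge_scales \<Delta>" "merge_scales \<Delta> \<inter> {r<..<b} = {}"
      using 2(1) by (auto simp: consecutive_merge_scales_def)
    then have r0: "0 \<le> r" using merge_scale_nonneg by blast
    obtain c where c: "c \<le> b" "first_scale C c"
      using first_scale_exists[of b C] rb r0 2 by auto
    have c0: "0 \<le> c" "C \<in> \<Delta> c" using c by (auto simp: first_scale_def)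
    \<comment> \<open>Otherwise \<open>C\<close> would lie in a single block at \<open>r\<close>,
      and all members of \<open>F\<close> would equal that block.\<close>
    have "\<not> c \<le> r"
    proof
      assume "c \<le> r"
      then obtain D' where D': "D' \<in> \<Delta> r" "C \<subseteq> D'"
        using coarsening c0 by blast
      have "X = D'" if X: "X \<in> F" for X
      proof -
        have "X \<in> \<Delta> r" using X 2 by blast
        moreover from this obtain x where "x \<in> X"
          using block_nonempty[OF r0] by blast
        moreover have "X \<subseteq> D'" using X 2 D' by blast
        ultimately show ?thesis using block_eqI[OF r0] D' by blast
      qed
      then show False using 2 by metis
    qed
    moreover have "c \<in> merge_scales \<Delta>"
      by (rule first_scale_merge_scale[OF c(2)])
    ultimately have "c = b" using c(1) rb(3) by force
    then show ?thesis using c by simp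
  qed
qed

text \<open>As first scales are unique, the pairs inject into the subsets of \<open>A\<close>.
  Finiteness matters because \<open>mset_set\<close> of an infinite set is empty.\<close>

lemma finite_merge_sets: "finite {(C, b). first_scale C b}"
proof (rule finite_imageD)
  have "fst ` {(C, b). first_scale C b} \<subseteq> Pow A"
    using block_subset by (fastforce simp: first_scale_def)
  then show "finite (fst ` {(C, b). first_scale C b})"
    using finite_base finite_subset by blast
  show "inj_on fst {(C, b). first_scale C b}"
    by (auto intro!: inj_onI dest: first_scale_unique)
qed

lemma scale_le_death: "b \<le> s \<Longrightarrow> C \<in> \<Delta> s \<Longrightarrow> ereal s \<le> death_scale \<Delta> C b"
  unfolding death_scale_def by (rule SUP_upper) simp

lemma birth_le_death: "first_scale C b \<Longrightarrow> ereal b \<le> death_scale \<Delta> C b"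
  by (rule scale_le_death) (auto simp: first_scale_def)

text \<open>By definition of the supremum, \<open>C\<close> is a block at some scale beyond
  \<open>s\<close>; convexity fills the gap. The inequality is strict because the supremum need not
  be attained.\<close>

lemma block_before_death:
  assumes "first_scale C b" "b \<le> s" "ereal s < death_scale \<Delta> C b"
  shows "C \<in> \<Delta> s"
proof -
  obtain t where "b \<le> t" "C \<in> \<Delta> t" "s < t"
    using assms(3) by (auto simp: death_scale_def less_SUP_iff)
  then show ?thesis
    using block_convex[of b s t C] assms by (auto simp: first_scale_def)
qed

end

section \<open>Single-linkage clusters\<close>

text \<open>The closure gives induction along chains. The point \<open>a\<close> must lie in
  \<open>A\<close>, because the closure is reflexive everywhere.\<close>

lemma same_cluster_iff_rtranclp:
  assumes "a \<in> A"
  shows "same_cluster A s a b \<longleftrightarrow> (\<lambda>x y. x \<in> A \<and> y \<in> A \<and> dist x y \<le> 2 * s)\<^sup>*\<^sup>* a b"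
    (is "_ \<longleftrightarrow> ?R\<^sup>*\<^sup>* a b")
proof
  assume "same_cluster A s a b"
  then obtain xs where "xs \<noteq> []" "set xs \<subseteq> A" "hd xs = a" "last xs = b"
      "successively (\<lambda>x y. dist x y \<le> 2 * s) xs"
    unfolding same_cluster_def by blast
  then show "?R\<^sup>*\<^sup>* a b"
  proof (induction xs arbitrary: a)
    case (Cons x xs)
    show ?case
    proof (cases xs)
      case Nil
      then show ?thesis using Cons.prems by simp
    next
      case (Cons y ys)
      have "?R\<^sup>*\<^sup>* y b" using Cons Cons.prems by (intro Cons.IH) auto
      moreover have "?R x y" using Cons Cons.prems by auto
      ultimately show ?thesis using Cons.prems by (auto intro: converse_rtranclp_into_rtranclp)
    qed
  qed simp
next
  assume "?R\<^sup>*\<^sup>* a b"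
  then show "same_cluster A s a b"
    using assms
  proof (induction rule: converse_rtranclp_induct)
    case base
    then show ?case
      unfolding same_cluster_def by (intro exI[of _ "[b]"]) simp
  next
    case (step x y)
    then obtain ys where "ys \<noteq> []" "set ys \<subseteq> A" "hd ys = y" "last ys = b"
      "successively (\<lambda>x y. dist x y \<le> 2 * s) ys"
      unfolding same_cluster_def by blast
    with step show ?case
      unfolding same_cluster_def
      by (intro exI[of _ "x # ys"]) (auto simp: successively_Cons)
  qed
qed

lemma same_cluster_refl: "a \<in> A \<Longrightarrow> same_cluster A s a a"
  by (simp add: same_cluster_iff_rtranclp)

lemma same_cluster_edge: "a \<in> A \<Longrightarrow> b \<in> A \<Longrightarrow> dist a b \<le> 2 * s \<Longrightarrow> same_cluster A s a b"
  by (simp add: same_cluster_iff_rtranclp r_into_rtranclp)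

lemma same_cluster_trans:
  "a \<in> A \<Longrightarrow> b \<in> A \<Longrightarrow> same_cluster A s a b \<Longrightarrow> same_cluster A s b c \<Longrightarrow> same_cluster A s a c"
  by (auto simp: same_cluster_iff_rtranclp)

lemma same_cluster_sym:
  assumes "a \<in> A" "b \<in> A" "same_cluster A s a b"
  shows "same_cluster A s b a"
proof -
  have "symp (\<lambda>x y. x \<in> A \<and> y \<in> A \<and> dist x y \<le> 2 * s)"
    by (auto intro!: sympI simp: dist_commute)
  from sympD[OF symp_rtranclp[OF this], of a b] show ?thesis
    using assms by (simp add: same_cluster_iff_rtranclp)
qed

lemma same_cluster_mono: "s \<le> t \<Longrightarrow> same_cluster A s a b \<Longrightarrow> same_cluster A t a b"
  unfolding same_cluster_def by (force elim: successively_mono)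

lemma equiv_same_cluster: "equiv A {(a, b). a \<in> A \<and> b \<in> A \<and> same_cluster A s a b}"
  by (intro equivI refl_onI symI transI)
    (auto intro: same_cluster_refl same_cluster_sym same_cluster_trans)

text \<open>Serves to verify that a given set is a cluster without choosing a
  representative.\<close>

lemma single_linkage_iff:
  "C \<in> single_linkage A s
     \<longleftrightarrow> C \<noteq> {} \<and> C \<subseteq> A \<and> (\<forall>x\<in>C. \<forall>y\<in>A. y \<in> C \<longleftrightarrow> same_cluster A s x y)"
proof
  assume "C \<in> single_linkage A s"
  then obtain a where a: "a \<in> A" "C = {y\<in>A. same_cluster A s a y}"
    by (auto simp: single_linkage_def quotient_def)
  then show "C \<noteq> {} \<and> C \<subseteq> A \<and> (\<forall>x\<in>C. \<forall>y\<in>A. y \<in> C \<longleftrightarrow> same_cluster A s x y)"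
    using same_cluster_refl[of a A s] same_cluster_trans[of _ A] same_cluster_sym[of a A] by blast
next
  assume C: "C \<noteq> {} \<and> C \<subseteq> A \<and> (\<forall>x\<in>C. \<forall>y\<in>A. y \<in> C \<longleftrightarrow> same_cluster A s x y)"
  then obtain a where "a \<in> C" by blast
  then have "C = {(a, b). a \<in> A \<and> b \<in> A \<and> same_cluster A s a b} `` {a}" "a \<in> A"
    using C by auto
  then show "C \<in> single_linkage A s"
    unfolding single_linkage_def by (metis quotientI)
qed

lemma single_linkage_cong:
  assumes "\<And>x y. x \<in> A \<Longrightarrow> y \<in> A \<Longrightarrow> dist x y \<le> 2 * s \<longleftrightarrow> dist x y \<le> 2 * t"
  shows "single_linkage A s = single_linkage A t"
proof -
  have "(\<lambda>x y. x \<in> A \<and> y \<in> A \<and> dist x y \<le> 2 * s) = (\<lambda>x y. x \<in> A \<and> y \<in> A \<and> dist x y \<le> 2 * t)"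
    using assms by (auto intro!: ext)
  then have "same_cluster A s a b \<longleftrightarrow> same_cluster A t a b" if "a \<in> A" for a b
    using that by (simp add: same_cluster_iff_rtranclp)
  then show ?thesis
    unfolding single_linkage_def by (intro arg_cong[of _ _ "(//) A"]) auto
qed

text \<open>The partition depends only on which pairs have distance at most \<open>2 * s\<close>, so
  it changes only at half-distances.\<close>

lemma dendrogram_single_linkage:
  assumes "finite A"
  shows "dendrogram (single_linkage A) A (insert 0 ((\<lambda>(x, y). dist x y / 2) ` (A \<times> A)))"
    (is "dendrogram _ _ ?T")
proof
  show "finite A" by fact
  show fin: "finite ?T" using assms by simp
  fix s t :: real and C
  assume s: "0 \<le> s"
  show "partition_on A (single_linkage A s)"
    unfolding single_linkage_def by (rule partition_on_quotient[OF equiv_same_cluster])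
  show "\<exists>D\<in>single_linkage A t. C \<subseteq> D" if st: "s \<le> t" and C: "C \<in> single_linkage A s"
  proof -
    obtain a where "a \<in> A" "C = {(a, b). a \<in> A \<and> b \<in> A \<and> same_cluster A s a b} `` {a}"
      using C unfolding single_linkage_def by (rule quotientE)
    then show ?thesis
      using same_cluster_mono[OF st] unfolding single_linkage_def
      by (intro bexI[OF _ quotientI[of a]]) auto
  qed
  \<comment> \<open>\<open>Max ?X\<close> is the last candidate scale up to \<open>s\<close>; no
    pair becomes an edge between it and \<open>s\<close>.\<close>
  let ?X = "{t\<in>?T. t \<le> s}"
  have X: "finite ?X" "0 \<in> ?X" using fin s by auto
  then have m: "Max ?X \<in> ?X" using Max_in[of ?X] by blast
  have "single_linkage A u = single_linkage A s" if u: "u \<in> {Max ?X..s}" for u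
  proof (rule single_linkage_cong)
    fix x y assume xy: "x \<in> A" "y \<in> A"
    have "dist x y / 2 \<le> Max ?X" if "dist x y \<le> 2 * s"
      using xy that by (intro Max_ge[OF X(1)]) force
    then show "dist x y \<le> 2 * u \<longleftrightarrow> dist x y \<le> 2 * s"
      using u by force
  qed
  moreover have "0 \<le> Max ?X" using Max_ge[OF X] .
  ultimately show "\<exists>t\<in>?T. 0 \<le> t \<and> t \<le> s \<and> (\<forall>u\<in>{t..s}. single_linkage A u = single_linkage A s)"
    using m by blast
qed

section \<open>Clusters of Hausdorff-close sets\<close>

definition near :: "real \<Rightarrow> 'a::metric_space set \<Rightarrow> 'a set \<Rightarrow> 'a set" where
  "near \<delta> B C = {y\<in>B. \<exists>x\<in>C. dist x y \<le> \<delta>}"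

text \<open>Each point of a chain in \<open>A\<close> is replaced by a point of \<open>B\<close>
  within \<open>\<delta>\<close>. A step of length at most \<open>2 * s\<close> grows by at most
  \<open>2 * \<delta>\<close>, so the scale grows by \<open>\<delta>\<close>.\<close>

lemma same_cluster_transfer:
  assumes cov: "\<And>x. x \<in> A \<Longrightarrow> \<exists>y\<in>B. dist x y \<le> \<delta>" and "0 \<le> s"
    and "a \<in> A" "same_cluster A s a a'" "b \<in> B" "b' \<in> B" "dist a b \<le> \<delta>" "dist a' b' \<le> \<delta>"
  shows "same_cluster B (s + \<delta>) b b'"
proof -
  have "(\<lambda>x y. x \<in> A \<and> y \<in> A \<and> dist x y \<le> 2 * s)\<^sup>*\<^sup>* a a'"
    using assms same_cluster_iff_rtranclp by blast
  then show ?thesis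
    using \<open>b' \<in> B\<close> \<open>dist a' b' \<le> \<delta>\<close>
  proof (induction arbitrary: b' rule: rtranclp_induct)
    case base
    have "dist b b' \<le> dist a b + dist a b'"
      by (metis dist_triangle3)
    then show ?case
      using base assms by (intro same_cluster_edge) auto
  next
    case (step x y)
    obtain c where c: "c \<in> B" "dist x c \<le> \<delta>" using cov step by blast
    have "dist c b' \<le> dist x c + dist x y + dist y b'"
      using dist_triangle3[of c b' x] dist_triangle[of x b' y] by simp
    then have "same_cluster B (s + \<delta>) c b'"
      using c step by (intro same_cluster_edge) auto
    then show ?case
      using step.IH[OF c] same_cluster_trans \<open>b \<in> B\<close> c(1) by blast
  qed
qed

text \<open>\<open>near \<delta> B C\<close> is connected at \<open>s + \<delta>\<close> because
  \<open>C\<close> is connected at \<open>s\<close>. It is maximal because a chain in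
  \<open>B\<close> leaving it would give a chain in \<open>A\<close> leaving \<open>C\<close> at
  scale \<open>s + 2 * \<delta>\<close>.\<close>

lemma near_single_linkage:
  assumes AB: "\<And>x. x \<in> A \<Longrightarrow> \<exists>y\<in>B. dist x y \<le> \<delta>"
    and BA: "\<And>y. y \<in> B \<Longrightarrow> \<exists>x\<in>A. dist x y \<le> \<delta>"
    and "0 \<le> \<delta>" "0 \<le> s"
    and C: "C \<in> single_linkage A s" "C \<in> single_linkage A (s + 2 * \<delta>)"
  shows "near \<delta> B C \<in> single_linkage B (s + \<delta>)" and "near \<delta> A (near \<delta> B C) = C"
proof -
  have CA: "C \<noteq> {}" "C \<subseteq> A" using C by (auto simp: single_linkage_iff)
  have BA': "\<exists>x\<in>A. dist y x \<le> \<delta>" if "y \<in> B" for y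
    using BA[OF that] by (simp add: dist_commute)
  have "z \<in> near \<delta> B C \<longleftrightarrow> same_cluster B (s + \<delta>) y z" if y: "y \<in> near \<delta> B C" and z: "z \<in> B" for y z
  proof
    obtain x where x: "x \<in> C" "dist x y \<le> \<delta>" "y \<in> B" using y by (auto simp: near_def)
    {
      assume "z \<in> near \<delta> B C"
      then obtain x' where x': "x' \<in> C" "dist x' z \<le> \<delta>" by (auto simp: near_def)
      then have "same_cluster A s x x'"
        using C(1) CA x by (auto simp: single_linkage_iff)
      then show "same_cluster B (s + \<delta>) y z"
        using same_cluster_transfer[OF AB, where s = s and a = x and a' = x'] x x' z CA \<open>0 \<le> s\<close>
        by blast
    }
    assume yz: "same_cluster B (s + \<delta>) y z"
    obtain w where w: "w \<in> A" "dist z w \<le> \<delta>" using BA' z by blast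
    have "same_cluster A (s + \<delta> + \<delta>) x w"
      using same_cluster_transfer[OF BA' _ x(3) yz, of x w] x w CA assms
      by (auto simp: dist_commute)
    then have "same_cluster A (s + 2 * \<delta>) x w"
      by (simp add: algebra_simps)
    then have "w \<in> C"
      using C(2) x w by (simp add: single_linkage_iff)
    then show "z \<in> near \<delta> B C" using w z by (auto simp: near_def dist_commute)
  qed
  moreover have "near \<delta> B C \<noteq> {}" using CA AB by (force simp: near_def)
  ultimately show "near \<delta> B C \<in> single_linkage B (s + \<delta>)"
    by (auto simp: single_linkage_iff near_def)
  show "near \<delta> A (near \<delta> B C) = C"
  proof (intro equalityI subsetI)
    fix x assume "x \<in> C"
    then show "x \<in> near \<delta> A (near \<delta> B C)"
      using AB CA by (force simp: near_def dist_commute)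
  next
    fix w assume "w \<in> near \<delta> A (near \<delta> B C)"
    then obtain x y where xy: "w \<in> A" "x \<in> C" "dist x y \<le> \<delta>" "dist y w \<le> \<delta>"
      by (auto simp: near_def)
    \<comment> \<open>Two steps of length at most \<open>\<delta>\<close> fit into one edge at scale
      \<open>s + 2 * \<delta>\<close>, where \<open>C\<close> is still a cluster.\<close>
    then have "dist x w \<le> 2 * (s + 2 * \<delta>)"
      using dist_triangle[of x w y] assms by simp
    then have "same_cluster A (s + 2 * \<delta>) x w"
      using xy CA by (intro same_cluster_edge) auto
    then show "w \<in> C" using C(2) xy by (simp add: single_linkage_iff)
  qed
qed

text \<open>As long as \<open>C\<close> survives for another \<open>2 * \<delta>\<close>, its near
  set is a cluster \<open>\<delta>\<close> later. The earliest such scale bounds the birth from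
  above, the latest ones bound the death from below.\<close>

lemma near_life_span:
  fixes A B :: "'a::metric_space set"
  assumes fin: "finite A" "finite B"
    and AB: "\<And>x. x \<in> A \<Longrightarrow> \<exists>y\<in>B. dist x y \<le> \<delta>"
    and BA: "\<And>y. y \<in> B \<Longrightarrow> \<exists>x\<in>A. dist x y \<le> \<delta>"
    and "0 \<le> \<delta>"
    and born: "merge_set_born_at (single_linkage A) C b"
    and long: "ereal (b + 2 * \<delta>) < death_scale (single_linkage A) C b"
  obtains c where "merge_set_born_at (single_linkage B) (near \<delta> B C) c" "c \<le> b + \<delta>"
    "death_scale (single_linkage A) C b \<le> death_scale (single_linkage B) (near \<delta> B C) c + ereal \<delta>"
    "near \<delta> A (near \<delta> B C) = C"
proof -
  interpret A: dendrogram "single_linkage A" A "insert 0 ((\<lambda>(x, y). dist x y / 2) ` (A \<times> A))"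
    by (rule dendrogram_single_linkage[OF fin(1)])
  interpret B: dendrogram "single_linkage B" B "insert 0 ((\<lambda>(x, y). dist x y / 2) ` (B \<times> B))"
    by (rule dendrogram_single_linkage[OF fin(2)])
  let ?d = "death_scale (single_linkage A) C b"
  have b: "A.first_scale C b" "0 \<le> b" "C \<in> single_linkage A b"
    using born by (auto simp: A.merge_set_born_at_iff A.first_scale_def)
  have alive: "near \<delta> B C \<in> single_linkage B (s + \<delta>) \<and> near \<delta> A (near \<delta> B C) = C"
    if "b \<le> s" "ereal (s + 2 * \<delta>) < ?d" for s
  proof -
    have "ereal s < ?d"
      using that(2) \<open>0 \<le> \<delta>\<close> by (cases ?d) auto
    then have "C \<in> single_linkage A s" "C \<in> single_linkage A (s + 2 * \<delta>)"
      using that \<open>0 \<le> \<delta>\<close> by (auto intro!: A.block_before_death[OF b(1)])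
    then show ?thesis
      using near_single_linkage[OF AB BA \<open>0 \<le> \<delta>\<close>, of s C] that b(2) by auto
  qed
  from alive[of b] long have D: "near \<delta> B C \<in> single_linkage B (b + \<delta>)" "near \<delta> A (near \<delta> B C) = C"
    by auto
  then obtain c where c: "c \<le> b + \<delta>" "B.first_scale (near \<delta> B C) c"
    using B.first_scale_exists[of "b + \<delta>"] b \<open>0 \<le> \<delta>\<close> by auto
  let ?e = "death_scale (single_linkage B) (near \<delta> B C) c"
  have "?d \<le> ?e + ereal \<delta>"
  \<comment> \<open>Real scales below the death of \<open>C\<close> suffice; this covers an infinite
    death and a supremum that is not attained.\<close>
  proof (rule dense_le_bounded[OF long])
    fix y assume y: "ereal (b + 2 * \<delta>) < y" "y < ?d"
    then obtain t where t: "y = ereal t" by (cases y) auto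
    \<comment> \<open>With \<open>s = t - 2 * \<delta>\<close> the later of the two scales is
      \<open>t\<close>, still before the death of \<open>C\<close>.\<close>
    have "near \<delta> B C \<in> single_linkage B (t - 2 * \<delta> + \<delta>)"
      using alive[of "t - 2 * \<delta>"] y t by auto
    then have "ereal (t - \<delta>) \<le> ?e"
      using y t c by (intro B.scale_le_death) (auto simp: algebra_simps)
    then have "ereal (t - \<delta>) + ereal \<delta> \<le> ?e + ereal \<delta>"
      by (rule add_right_mono)
    then show "y \<le> ?e + ereal \<delta>" using t by simp
  qed
  then show ?thesis
    using that[of c] c D by (simp add: B.merge_set_born_at_iff)
qed

section \<open>Distances between mergegram points and to the diagonal\<close>

text \<open>The additive bounds make both deaths infinite if one is; the bounds by births exclude
  \<open>-\<infinity>\<close>.\<close>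

lemma linf_dist_le:
  assumes "\<bar>b - b'\<bar> \<le> \<delta>" "ereal b \<le> d" "ereal b' \<le> d'" "d \<le> d' + ereal \<delta>" "d' \<le> d + ereal \<delta>"
  shows "linf_dist (b, d) (b', d') \<le> ereal \<delta>"
  using assms by (cases d; cases d') (auto simp: linf_dist_def zero_ereal_def)

lemma linf_dist_commute: "linf_dist x y = linf_dist y x"
proof (cases x; cases y)
  fix b d b' d' assume "x = (b, d)" "y = (b', d')"
  then show ?thesis
    by (cases d; cases d') (auto simp: linf_dist_def abs_minus_commute)
qed

text \<open>Here \<open>(b, d)\<close> has life span more than \<open>2 * \<delta>\<close>, while
  its partner \<open>(c, e)\<close> may be shorter. The reverse bounds are given only for a long
  partner; for a short one they follow from its shortness.\<close>

lemma linf_dist_long_le: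
  assumes "ereal (b + 2 * \<delta>) < d" "c \<le> b + \<delta>" "d \<le> e + ereal \<delta>" "ereal c \<le> e" "0 \<le> \<delta>"
    and "ereal (c + 2 * \<delta>) < e \<Longrightarrow> b \<le> c + \<delta> \<and> e \<le> d + ereal \<delta>"
  shows "linf_dist (c, e) (b, d) \<le> ereal \<delta>"
proof (cases "ereal (c + 2 * \<delta>) < e")
  case True
  then have "b \<le> c + \<delta>" "e \<le> d + ereal \<delta>" using assms(6) by auto
  then show ?thesis
    using assms(1-5) by (intro linf_dist_le) (cases d; auto)+
next
  \<comment> \<open>Now \<open>e \<le> c + 2 * \<delta>\<close>. So \<open>b + 2 * \<delta> < d
    \<le> e + \<delta> \<le> c + 3 * \<delta>\<close> bounds \<open>b\<close>, and \<open>e \<le> c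
    + 2 * \<delta> \<le> b + 3 * \<delta> < d + \<delta>\<close> bounds \<open>e\<close>.\<close>
  case False
  then show ?thesis
    using assms(1-5) by (intro linf_dist_le) (cases d; cases e; auto)+
qed

lemma near_diag:
  assumes "ereal b \<le> d" "\<not> ereal (b + 2 * \<delta>) < d"
  shows "\<exists>x. on_diag x \<and> linf_dist x (b, d) \<le> ereal \<delta>"
proof -
  obtain r where r: "d = ereal r" using assms by (cases d) auto
  \<comment> \<open>Moving to the midpoint changes either coordinate by half the life span, which is
    at most \<open>\<delta>\<close>.\<close>
  have "linf_dist ((b + r) / 2, ereal ((b + r) / 2)) (b, d) \<le> ereal \<delta>"
    using assms r by (intro linf_dist_le) (auto simp: abs_le_iff field_simps)
  then show ?thesis
    by (intro exI[of _ "((b + r) / 2, ereal ((b + r) / 2))"]) (simp add: on_diag_def)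
qed

section \<open>From the Hausdorff distance to a matching of mergegrams\<close>

text \<open>Since \<open>B\<close> is finite the infimum is attained, so no arbitrarily small excess
  over the bound is needed.\<close>

lemma hausdorff_dist_covers:
  assumes "finite A" "finite B" "B \<noteq> {}" "x \<in> A"
  shows "\<exists>y\<in>B. dist x y \<le> (SUP p\<in>A. INF q\<in>B. dist p q)"
proof -
  have "(INF q\<in>B. dist x q) \<in> dist x ` B"
    using assms by (metis cInf_eq_Min Min_in finite_imageI image_is_empty)
  then obtain y where "y \<in> B" "dist x y = (INF q\<in>B. dist x q)" by auto
  moreover have "(INF q\<in>B. dist x q) \<le> (SUP p\<in>A. INF q\<in>B. dist p q)"
    using assms by (intro cSUP_upper bdd_above_finite) auto
  ultimately show ?thesis by (intro bexI[of _ y]) simp_all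
qed

lemma is_matching_mergegram:
  fixes A B :: "'a::metric_space set"
  assumes fin: "finite A" "finite B"
    and AB: "\<And>x. x \<in> A \<Longrightarrow> \<exists>y\<in>B. dist x y \<le> \<delta>"
    and BA: "\<And>y. y \<in> B \<Longrightarrow> \<exists>x\<in>A. dist y x \<le> \<delta>"
    and "0 \<le> \<delta>"
  shows "\<exists>h. is_matching \<delta> (mergegram (single_linkage A)) (mergegram (single_linkage B)) h"
proof -
  interpret A: dendrogram "single_linkage A" A "insert 0 ((\<lambda>(x, y). dist x y / 2) ` (A \<times> A))"
    by (rule dendrogram_single_linkage[OF fin(1)])
  interpret B: dendrogram "single_linkage B" B "insert 0 ((\<lambda>(x, y). dist x y / 2) ` (B \<times> B))"
    by (rule dendrogram_single_linkage[OF fin(2)])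
  let ?bornA = "merge_set_born_at (single_linkage A)" and ?bornB = "merge_set_born_at (single_linkage B)"
  let ?dA = "death_scale (single_linkage A)" and ?dB = "death_scale (single_linkage B)"
  have AB': "\<exists>y\<in>B. dist y x \<le> \<delta>" if "x \<in> A" for x
    using AB[OF that] by (simp add: dist_commute)
  have BA': "\<exists>x\<in>A. dist x y \<le> \<delta>" if "y \<in> B" for y
    using BA[OF that] by (simp add: dist_commute)
  have uniqueA: "b = b'" if "?bornA C b" "?bornA C b'" for C b b'
    using that A.first_scale_unique by (simp add: A.merge_set_born_at_iff)
  have uniqueB: "c = c'" if "?bornB D c" "?bornB D c'" for D c c'
    using that B.first_scale_unique by (simp add: B.merge_set_born_at_iff)
  have leA: "ereal b \<le> ?dA C b" if "?bornA C b" for C b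
    using that A.birth_le_death by (simp add: A.merge_set_born_at_iff)
  have leB: "ereal c \<le> ?dB D c" if "?bornB D c" for D c
    using that B.birth_le_death by (simp add: B.merge_set_born_at_iff)
  have longA': "\<exists>c. ?bornB (near \<delta> B C) c \<and> c \<le> b + \<delta>
      \<and> ?dA C b \<le> ?dB (near \<delta> B C) c + ereal \<delta> \<and> near \<delta> A (near \<delta> B C) = C"
    if "?bornA C b" "ereal (b + 2 * \<delta>) < ?dA C b" for C b
    by (rule near_life_span[OF fin AB BA' \<open>0 \<le> \<delta>\<close> that]) blast+
  \<comment> \<open>As the birth of the near set is unique, any given \<open>c\<close> is the one
    supplied by \<open>longA'\<close>.\<close>
  have longA: "c \<le> b + \<delta> \<and> ?dA C b \<le> ?dB (near \<delta> B C) c + ereal \<delta>"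
    if "?bornA C b" "ereal (b + 2 * \<delta>) < ?dA C b" "?bornB (near \<delta> B C) c" for C b c
    using longA'[OF that(1,2)] uniqueB[OF that(3)] by blast
  have longB': "\<exists>b. ?bornA (near \<delta> A D) b \<and> b \<le> c + \<delta>
      \<and> ?dB D c \<le> ?dA (near \<delta> A D) b + ereal \<delta> \<and> near \<delta> B (near \<delta> A D) = D"
    if "?bornB D c" "ereal (c + 2 * \<delta>) < ?dB D c" for D c
    by (rule near_life_span[OF fin(2,1) BA AB' \<open>0 \<le> \<delta>\<close> that]) blast+
  have longB: "b \<le> c + \<delta> \<and> ?dB D c \<le> ?dA (near \<delta> A D) b + ereal \<delta>"
    if "?bornB D c" "ereal (c + 2 * \<delta>) < ?dB D c" "?bornA (near \<delta> A D) b" for D c b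
    using longB'[OF that(1,2)] uniqueA[OF that(3)] by blast
  define I where "I = {(C, b). ?bornA C b}"
  define J where "J = {(D, c). ?bornB D c}"
  \<comment> \<open>One long member suffices, as its partner may be short. The two equations for
    \<open>near\<close>, with unique births, make \<open>S\<close> injective in both
    coordinates.\<close>
  define S where "S = {((C, b), (D, c)). ?bornA C b \<and> ?bornB D c \<and> near \<delta> B C = D \<and> near \<delta> A D = C
      \<and> (ereal (b + 2 * \<delta>) < ?dA C b \<or> ereal (c + 2 * \<delta>) < ?dB D c)}"
  have SD: "?bornA C b \<and> ?bornB D c \<and> near \<delta> B C = D \<and> near \<delta> A D = C
      \<and> (ereal (b + 2 * \<delta>) < ?dA C b \<or> ereal (c + 2 * \<delta>) < ?dB D c)"
    if "((C, b), (D, c)) \<in> S" for C b D c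
    using that unfolding S_def by simp
  show ?thesis
    unfolding mergegram_def I_def[symmetric] J_def[symmetric]
  proof (rule is_matching_of_partial_matching)
    show "finite I" "finite J"
      using A.finite_merge_sets B.finite_merge_sets
      by (auto simp: I_def J_def A.merge_set_born_at_iff B.merge_set_born_at_iff)
    show "S \<subseteq> I \<times> J" by (auto simp: S_def I_def J_def)
    have "D = D' \<and> c = c'" if "((C, b), (D, c)) \<in> S" "((C, b), (D', c')) \<in> S" for C b D c D' c'
      using SD[OF that(1)] SD[OF that(2)] uniqueB by metis
    then show "inj_on fst S"
      by (intro inj_onI) force
    have "C = C' \<and> b = b'" if "((C, b), (D, c)) \<in> S" "((C', b'), (D, c)) \<in> S" for C b D c C' b'
      using SD[OF that(1)] SD[OF that(2)] uniqueA by metis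
    then show "inj_on snd S"
      by (intro inj_onI) force
    show "0 \<le> \<delta>" by fact
  next
    fix i j assume "(i, j) \<in> S"
    moreover obtain C b D c where ij: "i = (C, b)" "j = (D, c)" by (cases i; cases j)
    ultimately have born: "?bornA C b" "?bornB D c"
      and CD: "near \<delta> B C = D" "near \<delta> A D = C"
      and "ereal (b + 2 * \<delta>) < ?dA C b \<or> ereal (c + 2 * \<delta>) < ?dB D c"
      using SD by auto
    then consider "ereal (b + 2 * \<delta>) < ?dA C b" | "ereal (c + 2 * \<delta>) < ?dB D c" by blast
    then have "linf_dist (c, ?dB D c) (b, ?dA C b) \<le> ereal \<delta>"
    proof cases
      case 1
      \<comment> \<open>If \<open>D\<close> is long as well, \<open>longB\<close> supplies the
        reverse bounds, because \<open>near \<delta> A D = C\<close>.\<close>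
      then show ?thesis
        using longA[OF born(1) 1, of c] longB[OF born(2), of b] CD born leB \<open>0 \<le> \<delta>\<close>
        by (intro linf_dist_long_le) auto
    next
      case 2
      then have "linf_dist (b, ?dA C b) (c, ?dB D c) \<le> ereal \<delta>"
        using longB[OF born(2) 2, of b] longA[OF born(1), of c] CD born leA \<open>0 \<le> \<delta>\<close>
        by (intro linf_dist_long_le) auto
      then show ?thesis by (simp add: linf_dist_commute)
    qed
    then show "linf_dist (case j of (D, c) \<Rightarrow> (c, ?dB D c)) (case i of (C, b) \<Rightarrow> (b, ?dA C b)) \<le> ereal \<delta>"
      by (simp add: ij)
  next
    fix i assume i: "i \<in> I - fst ` S"
    obtain C b where Cb: "i = (C, b)" by (cases i)
    then have C: "?bornA C b" using i by (simp add: I_def)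
    \<comment> \<open>A long merge set is paired with its near set in \<open>S\<close>, so an
      unmatched one is short and close to the diagonal.\<close>
    have "\<not> ereal (b + 2 * \<delta>) < ?dA C b"
    proof
      assume long: "ereal (b + 2 * \<delta>) < ?dA C b"
      then obtain c where "?bornB (near \<delta> B C) c" "near \<delta> A (near \<delta> B C) = C"
        using longA'[OF C] by blast
      then have "(i, (near \<delta> B C, c)) \<in> S"
        using long C by (simp add: S_def Cb)
      then show False using i by force
    qed
    then show "\<exists>x. on_diag x \<and> linf_dist x (case i of (C, b) \<Rightarrow> (b, ?dA C b)) \<le> ereal \<delta>"
      using near_diag leA[OF C] by (simp add: Cb)
  next
    fix j assume j: "j \<in> J - snd ` S"
    obtain D c where Dc: "j = (D, c)" by (cases j)
    then have D: "?bornB D c" using j by (simp add: J_def)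
    have "\<not> ereal (c + 2 * \<delta>) < ?dB D c"
    proof
      assume long: "ereal (c + 2 * \<delta>) < ?dB D c"
      then obtain b where "?bornA (near \<delta> A D) b" "near \<delta> B (near \<delta> A D) = D"
        using longB'[OF D] by blast
      then have "((near \<delta> A D, b), j) \<in> S"
        using long D by (simp add: S_def Dc)
      then show False using j by force
    qed
    then show "\<exists>x. on_diag x \<and> linf_dist (case j of (D, c) \<Rightarrow> (c, ?dB D c)) x \<le> ereal \<delta>"
      using near_diag leB[OF D] by (simp add: Dc linf_dist_commute[of "(c, _)"])
  qed
qed

theorem theorem5p8:
  fixes A B :: "'a::metric_space set"
  assumes "finite A" and "A \<noteq> {}" and "finite B" and "B \<noteq> {}"
  shows "bottleneck_dist (mergegram (single_linkage A)) (mergegram (single_linkage B))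
           \<le> ereal (hausdorff_dist A B)"
proof -
  let ?\<delta> = "hausdorff_dist A B"
  have AB: "\<exists>y\<in>B. dist x y \<le> ?\<delta>" if "x \<in> A" for x
    using hausdorff_dist_covers[OF assms(1,3,4) that] by (auto simp: hausdorff_dist_def le_max_iff_disj)
  have BA: "\<exists>x\<in>A. dist y x \<le> ?\<delta>" if "y \<in> B" for y
    using hausdorff_dist_covers[OF assms(3,1,2) that]
    by (auto simp: hausdorff_dist_def dist_commute le_max_iff_disj)
  have "0 \<le> ?\<delta>"
    using AB assms(2) by (meson all_not_in_conv order_trans zero_le_dist)
  then show ?thesis
    using is_matching_mergegram[OF assms(1,3) AB BA]
    unfolding bottleneck_dist_def by (intro INF_lower) auto
qed

end
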